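(* For each $i<\omega$, let $k(i)\in\mathbb N$ and let $\vec a_i=\langle a_{i,0},a_{i,1},\ldots,a_{i,k(i)}\rangle$ be a compressed sequence in $\mathbb Z\setminus\{0\}$ with $a_{i,k(i)}=1$. Let $p$ be a minimal idempotent in $(\beta\mathbb N,+)$ and let $A\in p$. Then there exist sequences $\langle b_n\rangle_{n=0}^\infty$ and $\langle x_n\rangle_{n=0}^\infty$ in $\mathbb N$ such that $FS(\langle x_n\rangle_{n=0}^\infty)\subseteq A$ and, for each $i\in\omega$, $b_i+MT(\vec a_i,\langle x_n\rangle_{n=i}^\infty)\subseteq A$.
   Context: $\mathbb N=\{1,2,3,\ldots\}$, $\omega=\{0,1,2,\ldots\}$. For a set $X$, $\mathcal P_f(X)$ is the set of finite nonempty subsets of $X$. For $F,G\in\mathcal P_f(\omega)$, $F<G$ means $\max F<\min G$. A finite sequence $\langle a_0,\ldots,a_k\rangle$ of integers is compressed if no $a_i=0$ and $a_i\neq a_{i+1}$ for each $i\in\{0,1,\ldots,k-1\}$. $FS(\langle x_n\rangle_{n=0}^\infty)=\{\sum_{n\in F}x_n: F\in\mathcal P_f(\omega)\}$. For a compressed sequence $\vec a=\langle a_0,\ldots,a_k\rangle$ and $i\in\omega$, $MT(\vec a,\langle x_n\rangle_{n=i}^\infty)=\{\sum_{j=0}^k a_j\sum_{t\in F_j}x_t: F_0,F_1,\ldots,F_k\in\mathcal P_f(\{i,i+1,i+2,\ldots\})\text{ and }F_0<F_1<\cdots<F_k\}$. For $b\in\mathbb N$ and a set $X$ of integers, $b+X=\{b+x:x\in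 X\}$. $\beta\mathbb N$ is the Stone–Čech compactification of the discrete space $\mathbb N$, viewed as the set of ultrafilters on $\mathbb N$, with addition given by: $A\in p+q$ if and only if $\{x\in\mathbb N:-x+A\in q\}\in p$, where $-x+A=\{y\in\mathbb N:x+y\in A\}$. This is a compact Hausdorff right topological semigroup, having a smallest two-sided ideal $K(\beta\mathbb N)$; a minimal idempotent is an idempotent $p=p+p$ belonging to $K(\beta\mathbb N)$. *)

theory Defs
  imports Main
begin

abbreviation posN :: "nat set" where
  "posN \<equiv> {1..}"

definition Pf :: "'a set \<Rightarrow> 'a set set" where
  "Pf X = {F. F \<subseteq> X \<and> finite F \<and> F \<noteq> {}}"

definition block_less :: "nat set \<Rightarrow> nat set \<Rightarrow> bool" where
  "block_less F G \<longleftrightarrow> Max F < Min G"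

(* A finite sequence a_0, ..., a_k is a function a together with its last index k;
   the values of a beyond k are irrelevant. *)
definition compressed :: "nat \<Rightarrow> (nat \<Rightarrow> int) \<Rightarrow> bool" where
  "compressed k a \<longleftrightarrow> (\<forall>j\<le>k. a j \<noteq> 0) \<and> (\<forall>j<k. a j \<noteq> a (Suc j))"

definition FS :: "(nat \<Rightarrow> nat) \<Rightarrow> nat set" where
  "FS x = {\<Sum>n\<in>F. x n | F. F \<in> Pf UNIV}"

(* The set MT(a, x_i, x_(i+1), ...) for the sequence a_0, ..., a_k. *)
definition MT :: "nat \<Rightarrow> (nat \<Rightarrow> int) \<Rightarrow> nat \<Rightarrow> (nat \<Rightarrow> nat) \<Rightarrow> int set" where
  "MT k a i x = {\<Sum>j\<le>k. a j * (\<Sum>t\<in>F j. int (x t)) | F :: nat \<Rightarrow> nat set.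
     (\<forall>j\<le>k. F j \<in> Pf {i..}) \<and> (\<forall>j<k. block_less (F j) (F (Suc j)))}"

definition ultrafilter_on :: "'a set \<Rightarrow> 'a set set \<Rightarrow> bool" where
  "ultrafilter_on X U \<longleftrightarrow>
     U \<subseteq> Pow X \<and> X \<in> U \<and> {} \<notin> U \<and>
     (\<forall>A\<in>U. \<forall>B\<in>U. A \<inter> B \<in> U) \<and>
     (\<forall>A\<in>U. \<forall>B. A \<subseteq> B \<and> B \<subseteq> X \<longrightarrow> B \<in> U) \<and>
     (\<forall>A. A \<subseteq> X \<longrightarrow> A \<in> U \<or> X - A \<in> U)"

definition betaN :: "nat set set set" where
  "betaN = {p. ultrafilter_on posN p}"

definition beta_add :: "nat set set \<Rightarrow> nat set set \<Rightarrow> nat set set" where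
  "beta_add p q = {A. A \<subseteq> posN \<and> {x \<in> posN. {y \<in> posN. x + y \<in> A} \<in> q} \<in> p}"

definition two_sided_ideal :: "nat set set set \<Rightarrow> bool" where
  "two_sided_ideal I \<longleftrightarrow>
     I \<noteq> {} \<and> I \<subseteq> betaN \<and> (\<forall>p\<in>I. \<forall>q\<in>betaN. beta_add p q \<in> I \<and> beta_add q p \<in> I)"

definition smallest_ideal :: "nat set set set \<Rightarrow> bool" where
  "smallest_ideal K \<longleftrightarrow> two_sided_ideal K \<and> (\<forall>I. two_sided_ideal I \<longrightarrow> K \<subseteq> I)"

(* K(beta N) is the K with smallest_ideal K. It is unique by definition, and it exists because
   beta N is a compact right topological semigroup. *)
definition minimal_idempotent :: "nat set set \<Rightarrow> bool" where
  "minimal_idempotent p \<longleftrightarrow>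
     p \<in> betaN \<and> beta_add p p = p \<and> (\<exists>K. smallest_ideal K \<and> p \<in> K)"

end

(* In \<beta>\<int>, the combination s = a_0 p + ... + a_k p with a_k = 1 satisfies s = s + p, and it lies in
   \<beta>\<nat> because p is nonprincipal. Hence s belongs to the left ideal \<beta>\<nat> + p, which is minimal
   because p is in the smallest ideal, so p \<in> \<beta>\<nat> + s. Thus every A \<in> p has a translate -b + A in s.
   Given such a shift for each of the countably many sequences, the x_n are chosen one at a time,
   as in the proof of the Milliken-Taylor theorem: idempotency of p keeps the finitely many
   promises made so far satisfiable. *)

theory Submission
  imports Defs
begin

section \<open>Filters\<close>

text \<open>Zorn's lemma downwards. The infimum of a chain stays proper because each finite nonempty
  subchain has its least member as infimum. \<open>Q\<close> is kept abstract to serve both for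
  ultrafilters and for minimal left ideals.\<close>

lemma ex_minimal_filter:
  fixes F0 :: "'a filter"
  assumes "Q F0" "F0 \<noteq> bot"
    and Inf: "\<And>C. C \<noteq> {} \<Longrightarrow> (\<And>F. F \<in> C \<Longrightarrow> Q F) \<Longrightarrow> Q (Inf C)"
  obtains F where "F \<le> F0" "Q F" "F \<noteq> bot" "\<And>G. G \<le> F \<Longrightarrow> Q G \<Longrightarrow> G \<noteq> bot \<Longrightarrow> G = F"
proof -
  let ?S = "{F. F \<le> F0 \<and> Q F \<and> F \<noteq> bot}"
  have "\<exists>F\<in>?S. \<forall>G\<in>?S. F \<ge> G \<longrightarrow> G = F"
  proof (rule predicate_Zorn)
    show "partial_order_on ?S (relation_of (\<ge>) ?S)"
      by (auto simp: partial_order_on_def preorder_on_def refl_on_def trans_def antisym_def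
          relation_of_def)
    fix C
    assume C: "C \<in> Chains (relation_of (\<ge>) ?S)"
    then have sub: "C \<subseteq> ?S" and tot: "\<And>F G. F \<in> C \<Longrightarrow> G \<in> C \<Longrightarrow> F \<le> G \<or> G \<le> F"
      by (auto simp: Chains_def relation_of_def)
    show "\<exists>U\<in>?S. \<forall>F\<in>C. F \<ge> U"
    proof (cases "C = {}")
      case True
      then show ?thesis using assms by auto
    next
      case False
      have fin: "Inf X \<in> X" if "finite X" "X \<noteq> {}" "X \<subseteq> C" for X
        using that
      proof (induction X rule: finite_ne_induct)
        case (insert F X)
        then have "Inf X \<in> X" "F \<le> Inf X \<or> Inf X \<le> F" using tot by auto
        then show ?case by (auto simp: inf_absorb1 inf_absorb2)
      qed simp
      obtain F where F: "F \<in> C" using False by blast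
      have "Inf C \<noteq> bot"
      proof (rule Inf_filter_not_bot)
        fix X assume X: "X \<subseteq> C" "finite X"
        show "Inf X \<noteq> bot"
        proof (cases "X = {}")
          case True
          moreover have "top \<noteq> (bot :: 'a filter)"
            using \<open>F0 \<noteq> bot\<close> top_greatest[of F0] bot_unique by metis
          ultimately show ?thesis by simp
        next
          case False
          then show ?thesis using fin[OF X(2) _ X(1)] X(1) sub by auto
        qed
      qed
      moreover have "Q (Inf C)" using sub False by (intro Inf) auto
      moreover have "Inf C \<le> F0" using sub F by (auto intro: Inf_lower2)
      ultimately show ?thesis by (auto intro!: bexI[of _ "Inf C"] Inf_lower)
    qed
  qed
  then obtain F where "F \<in> ?S" and "\<And>G. G \<in> ?S \<Longrightarrow> G \<le> F \<Longrightarrow> G = F" by blast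
  then show ?thesis using that[of F] by (simp add: order.trans)
qed

text \<open>Meeting a minimal proper filter with \<open>{x. P x}\<close> either collapses it, so
  that \<open>P\<close> fails eventually, or by minimality changes nothing.\<close>

lemma ex_ultrafilter_le:
  fixes F :: "'a filter"
  assumes "F \<noteq> bot"
  obtains U where "U \<le> F" "U \<noteq> bot" "\<And>P. eventually P U \<or> eventually (\<lambda>x. \<not> P x) U"
proof -
  obtain U where U: "U \<le> F" "U \<noteq> bot" and min: "\<And>G. G \<le> U \<Longrightarrow> G \<noteq> bot \<Longrightarrow> G = U"
    by (rule ex_minimal_filter[of "\<lambda>_. True" F]) (use assms in auto)
  have "eventually P U \<or> eventually (\<lambda>x. \<not> P x) U" for P
  proof (cases "inf U (principal {x. P x}) = bot")
    case True
    then show ?thesis by (simp add: trivial_limit_def eventually_inf_principal)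
  next
    case False
    then have "inf U (principal {x. P x}) = U" using min by simp
    then have "U \<le> principal {x. P x}" by (simp add: inf.absorb_iff1)
    then show ?thesis by (simp add: le_principal)
  qed
  with U show ?thesis using that by blast
qed

section \<open>Ultrafilters on the positive integers as quantifiers\<close>

text \<open>As a filter on \<open>nat\<close>, \<open>p\<close> acts as a quantifier, and sums of
  ultrafilters become nested quantifiers.\<close>

definition filter_of :: "nat set set \<Rightarrow> nat filter" where
  "filter_of p = Abs_filter (\<lambda>P. {x \<in> posN. P x} \<in> p)"

lemma eventually_filter_of:
  assumes "p \<in> betaN"
  shows "eventually P (filter_of p) \<longleftrightarrow> {x \<in> posN. P x} \<in> p"
proof -
  have U: "ultrafilter_on posN p" using assms by (simp add: betaN_def)
  show ?thesis
    unfolding filter_of_def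
  proof (rule eventually_Abs_filter, rule is_filter.intro)
    show "{x \<in> posN. True} \<in> p" using U by (simp add: ultrafilter_on_def atLeast_def)
    fix P Q
    show "{x \<in> posN. P x \<and> Q x} \<in> p" if "{x \<in> posN. P x} \<in> p" "{x \<in> posN. Q x} \<in> p"
    proof -
      have "{x \<in> posN. P x} \<inter> {x \<in> posN. Q x} \<in> p"
        using U that unfolding ultrafilter_on_def by blast
      also have "{x \<in> posN. P x} \<inter> {x \<in> posN. Q x} = {x \<in> posN. P x \<and> Q x}" by auto
      finally show ?thesis .
    qed
    show "{x \<in> posN. Q x} \<in> p" if "\<forall>x. P x \<longrightarrow> Q x" "{x \<in> posN. P x} \<in> p"
    proof -
      have "{x \<in> posN. P x} \<subseteq> {x \<in> posN. Q x}" "{x \<in> posN. Q x} \<subseteq> posN" using that by auto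
      then show ?thesis using U that unfolding ultrafilter_on_def by blast
    qed
  qed
qed

lemma mem_iff_filter_of:
  assumes "p \<in> betaN"
  shows "A \<in> p \<longleftrightarrow> A \<subseteq> posN \<and> (\<forall>\<^sub>F x in filter_of p. x \<in> A)"
proof -
  have "{x \<in> posN. x \<in> A} = A" if "A \<subseteq> posN" using that by auto
  moreover have "A \<in> p \<Longrightarrow> A \<subseteq> posN" using assms by (auto simp: betaN_def ultrafilter_on_def)
  ultimately show ?thesis by (auto simp: eventually_filter_of[OF assms])
qed

lemma filter_of_pos:
  assumes "p \<in> betaN"
  shows "\<forall>\<^sub>F x in filter_of p. 0 < x"
proof -
  have "{x \<in> posN. 0 < x} = posN" by auto
  then show ?thesis using assms by (simp add: eventually_filter_of betaN_def ultrafilter_on_def)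
qed

lemma filter_of_neq_bot: "p \<in> betaN \<Longrightarrow> filter_of p \<noteq> bot"
  by (simp add: trivial_limit_def eventually_filter_of)
    (simp add: betaN_def ultrafilter_on_def)

lemma filter_of_ultra:
  assumes "p \<in> betaN"
  shows "eventually (\<lambda>x. \<not> P x) (filter_of p) \<longleftrightarrow> \<not> eventually P (filter_of p)"
proof
  assume "eventually (\<lambda>x. \<not> P x) (filter_of p)"
  then show "\<not> eventually P (filter_of p)"
    using eventually_conj[of P "filter_of p" "\<lambda>x. \<not> P x"] filter_of_neq_bot[OF assms] by auto
next
  assume "\<not> eventually P (filter_of p)"
  then have "{x \<in> posN. P x} \<notin> p" by (simp only: eventually_filter_of[OF assms] not_False_eq_True)
  moreover have "ultrafilter_on posN p" using assms by (simp add: betaN_def)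
  moreover have "{x \<in> posN. P x} \<subseteq> posN" by auto
  ultimately have "posN - {x \<in> posN. P x} \<in> p" unfolding ultrafilter_on_def by metis
  also have "posN - {x \<in> posN. P x} = {x \<in> posN. \<not> P x}" by auto
  finally show "eventually (\<lambda>x. \<not> P x) (filter_of p)" by (simp add: eventually_filter_of assms)
qed

text \<open>For sums and linear combinations of ultrafilters \<open>L\<close> is a nested
  quantifier, so the criterion asks only for logical laws of \<open>L\<close>.\<close>

lemma betaN_I:
  assumes "\<And>A. A \<in> p \<longleftrightarrow> A \<subseteq> posN \<and> L (\<lambda>x. x \<in> A)"
    and "\<not> L (\<lambda>x. False)" "L (\<lambda>x. 0 < x)"
    and "\<And>P Q. L P \<Longrightarrow> L Q \<Longrightarrow> L (\<lambda>x. P x \<and> Q x)"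
    and mono: "\<And>P Q. L P \<Longrightarrow> (\<And>x. P x \<Longrightarrow> Q x) \<Longrightarrow> L Q"
    and "\<And>P. L P \<or> L (\<lambda>x. \<not> P x)"
  shows "p \<in> betaN"
proof -
  have "L (\<lambda>x. x \<in> posN - A)" if "\<not> L (\<lambda>x. x \<in> A)" for A
  proof -
    have "L (\<lambda>x. \<not> x \<in> A \<and> 0 < x)" using assms that by blast
    then show ?thesis by (rule mono) auto
  qed
  moreover have "L (\<lambda>x. x \<in> posN)" using assms(3) by (rule mono) auto
  moreover have "L (\<lambda>x. x \<in> A \<inter> B)" if "L (\<lambda>x. x \<in> A)" "L (\<lambda>x. x \<in> B)" for A B
    using assms(4)[OF that] by simp
  moreover have "L (\<lambda>x. x \<in> B)" if "L (\<lambda>x. x \<in> A)" "A \<subseteq> B" for A B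
    using that(1) by (rule mono) (use that(2) in blast)
  moreover have "\<not> L (\<lambda>x. x \<in> {})" using assms(2) by simp
  ultimately show ?thesis
    unfolding betaN_def ultrafilter_on_def mem_Collect_eq
    by (intro conjI ballI allI impI subsetI) (simp_all only: assms(1) Pow_iff, blast+)
qed

lemma ultrafilter_in_betaN:
  assumes U: "U \<noteq> bot" "\<And>P. eventually P U \<or> eventually (\<lambda>x. \<not> P x) U"
    and pos: "\<forall>\<^sub>F x in U. 0 < x"
  obtains p where "p \<in> betaN" "filter_of p = U"
proof -
  define p where "p = {A. A \<subseteq> posN \<and> (\<forall>\<^sub>F x in U. x \<in> A)}"
  have p: "p \<in> betaN"
  proof (rule betaN_I[where L = "\<lambda>P. eventually P U"])
    show "eventually Q U" if "eventually P U" "\<And>x. P x \<Longrightarrow> Q x" for P Q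
      using that by (rule eventually_mono)
  qed (use assms in \<open>simp_all add: p_def eventually_conj\<close>)
  moreover have "filter_of p = U"
  proof -
    have "(\<forall>\<^sub>F x in U. 0 < x \<and> P x) \<longleftrightarrow> eventually P U" for P
      using pos by (simp add: eventually_conj_iff)
    moreover have "{x \<in> posN. P x} \<subseteq> posN" for P :: "nat \<Rightarrow> bool" by auto
    ultimately show ?thesis
      unfolding filter_eq_iff eventually_filter_of[OF p] by (simp add: p_def Suc_le_eq)
  qed
  ultimately show ?thesis using that by blast
qed

section \<open>The semigroup of ultrafilters\<close>

lemma beta_add_mem:
  assumes "p \<in> betaN" "q \<in> betaN"
  shows "A \<in> beta_add p q \<longleftrightarrow>
    A \<subseteq> posN \<and> (\<forall>\<^sub>F x in filter_of p. \<forall>\<^sub>F y in filter_of q. x + y \<in> A)"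
  by (simp add: beta_add_def eventually_filter_of assms)

lemma beta_add_closed:
  assumes "p \<in> betaN" "q \<in> betaN"
  shows "beta_add p q \<in> betaN"
proof (rule betaN_I[OF beta_add_mem[OF assms]])
  show "\<not> (\<forall>\<^sub>F x in filter_of p. \<forall>\<^sub>F y in filter_of q. False)"
    using assms by (simp add: filter_of_neq_bot)
  show "\<forall>\<^sub>F x in filter_of p. \<forall>\<^sub>F y in filter_of q. 0 < x + y"
    using filter_of_pos[OF assms(1)] by eventually_elim simp
  show "(\<forall>\<^sub>F x in filter_of p. \<forall>\<^sub>F y in filter_of q. P (x + y)) \<or>
    (\<forall>\<^sub>F x in filter_of p. \<forall>\<^sub>F y in filter_of q. \<not> P (x + y))" for P
    by (simp add: filter_of_ultra assms)
  show "\<forall>\<^sub>F x in filter_of p. \<forall>\<^sub>F y in filter_of q. Q (x + y)"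
    if "\<forall>\<^sub>F x in filter_of p. \<forall>\<^sub>F y in filter_of q. P (x + y)" "\<And>x. P x \<Longrightarrow> Q x" for P Q
    using that(1) by (rule eventually_mono) (use that(2) in \<open>auto elim: eventually_mono\<close>)
qed (simp add: eventually_conj_iff)

lemma eventually_beta_add:
  assumes "p \<in> betaN" "q \<in> betaN"
  shows "eventually P (filter_of (beta_add p q)) \<longleftrightarrow>
    (\<forall>\<^sub>F x in filter_of p. \<forall>\<^sub>F y in filter_of q. P (x + y))"
proof -
  have "(\<forall>\<^sub>F x in filter_of p. \<forall>\<^sub>F y in filter_of q. P (x + y)) \<longleftrightarrow>
      (\<forall>\<^sub>F x in filter_of p. \<forall>\<^sub>F y in filter_of q. x + y \<in> posN \<and> P (x + y))"
    by (rule eventually_subst, rule eventually_mono[OF filter_of_pos[OF assms(1)]]) simp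
  then show ?thesis
    by (auto simp: eventually_filter_of[OF beta_add_closed[OF assms]] beta_add_mem[OF assms])
qed

lemma beta_add_assoc:
  assumes "p \<in> betaN" "q \<in> betaN" "r \<in> betaN"
  shows "beta_add (beta_add p q) r = beta_add p (beta_add q r)"
  by (rule set_eqI)
    (simp add: beta_add_mem eventually_beta_add beta_add_closed assms add.assoc)

text \<open>Nonempty closed left ideals of \<open>betaN\<close> correspond to the proper filters that are
  invariant under all translations; the finest ones among them (minimal in the filter order)
  replace minimal left ideals.\<close>

definition translation_invariant :: "nat filter \<Rightarrow> bool" where
  "translation_invariant F \<longleftrightarrow>
     (\<forall>\<^sub>F x in F. 0 < x) \<and> (\<forall>b>0. \<forall>P. eventually P F \<longrightarrow> (\<forall>\<^sub>F y in F. P (b + y)))"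

text \<open>Invariance under \<open>b\<close> means \<open>filtermap ((+) b) F \<le> F\<close>, an
  inequality that survives infima by monotonicity.\<close>

lemma translation_invariant_Inf:
  assumes "C \<noteq> {}" "\<And>F. F \<in> C \<Longrightarrow> translation_invariant F"
  shows "translation_invariant (Inf C)"
proof -
  have "filtermap ((+) b) (Inf C) \<le> Inf C" if "b > 0" for b
  proof (rule Inf_greatest)
    fix F assume F: "F \<in> C"
    have "filtermap ((+) b) (Inf C) \<le> filtermap ((+) b) F"
      using F by (intro filtermap_mono Inf_lower)
    also have "\<dots> \<le> F"
      using assms(2)[OF F] that
      by (auto simp: translation_invariant_def le_filter_def eventually_filtermap)
    finally show "filtermap ((+) b) (Inf C) \<le> F" .
  qed
  moreover obtain F where "F \<in> C" using assms(1) by blast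
  then have "\<forall>\<^sub>F x in Inf C. 0 < x"
    using assms(2) by (meson Inf_lower filter_leD translation_invariant_def)
  ultimately show ?thesis
    by (auto simp: translation_invariant_def le_filter_def eventually_filtermap)
qed

text \<open>The ultrafilters \<open>q\<close> that lie in \<open>betaN + s\<close> for every \<open>s \<in> betaN + q\<close>,
  as far as single members of \<open>q\<close> can tell.\<close>

definition returning :: "nat set set set" where
  "returning = {q \<in> betaN. \<forall>A\<in>q. \<forall>u\<in>betaN.
     \<exists>b>0. \<forall>\<^sub>F y in filter_of (beta_add u q). b + y \<in> A}"

text \<open>Any ultrafilter below a minimal proper translation-invariant filter works, just as every
  element of a minimal left ideal generates the whole of it.\<close>

lemma returning_nonempty: "returning \<noteq> {}"
proof -
  have "translation_invariant (principal posN)"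
    by (auto simp: translation_invariant_def eventually_principal)
  moreover have "principal posN \<noteq> (bot :: nat filter)"
    by (auto simp: principal_eq_bot_iff)
  ultimately obtain F where F: "translation_invariant F" "F \<noteq> bot"
    and min: "\<And>G. G \<le> F \<Longrightarrow> translation_invariant G \<Longrightarrow> G \<noteq> bot \<Longrightarrow> G = F"
    using ex_minimal_filter translation_invariant_Inf by metis
  obtain U where U: "U \<le> F" "U \<noteq> bot" "\<And>P. eventually P U \<or> eventually (\<lambda>x. \<not> P x) U"
    using ex_ultrafilter_le[OF F(2)] by blast
  have "\<forall>\<^sub>F x in U. 0 < x"
    using U(1) F(1) by (auto simp: translation_invariant_def dest: filter_leD)
  with U obtain q where q: "q \<in> betaN" and qU: "filter_of q = U"
    using ultrafilter_in_betaN by metis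
  have "\<exists>b>0. \<forall>\<^sub>F y in filter_of (beta_add u q). b + y \<in> A" if A: "A \<in> q" and u: "u \<in> betaN" for A u
  proof (rule ccontr)
    assume contra: "\<not> ?thesis"
    define s where "s = beta_add u q"
    have s: "s \<in> betaN" using u q by (simp add: s_def beta_add_closed)
    \<comment> \<open>Invariance keeps \<open>s\<close>, that is \<open>u + q\<close>, in the left
      ideal of \<open>F\<close>.\<close>
    have le: "eventually P (filter_of s)" if "eventually P F" for P
    proof -
      have "\<forall>\<^sub>F y in filter_of q. P (x + y)" if "0 < x" for x
        using F(1) \<open>eventually P F\<close> that U(1)
        by (auto simp: translation_invariant_def qU dest: filter_leD)
      then show ?thesis
        unfolding s_def eventually_beta_add[OF u q]
        by (intro eventually_mono[OF filter_of_pos[OF u]])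
    qed
    \<comment> \<open>\<open>G\<close> is the filter of the closed left ideal
      \<open>betaN + s\<close>, so minimality will force \<open>G = F\<close>.\<close>
    define G where "G = (SUP b\<in>{0<..}. filtermap ((+) b) (filter_of s))"
    have G: "eventually P G \<longleftrightarrow> (\<forall>b>0. \<forall>\<^sub>F y in filter_of s. P (b + y))" for P
      by (auto simp: G_def eventually_Sup eventually_filtermap)
    have "G \<le> F"
      using F(1) le by (auto simp: le_filter_def G translation_invariant_def)
    moreover have "translation_invariant G"
      by (auto simp: translation_invariant_def G add.assoc[symmetric])
    moreover have "G \<noteq> bot"
      using filter_of_neq_bot[OF s] by (auto simp: trivial_limit_def G)
    ultimately have "G = F" by (rule min)
    \<comment> \<open>If no translation brings \<open>s\<close> into \<open>A\<close>, the
      complement of \<open>A\<close> is eventual for all translates of \<open>s\<close>, hence for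
      \<open>G = F\<close> and for \<open>q\<close>.\<close>
    moreover have "\<forall>\<^sub>F x in G. x \<notin> A"
      using contra unfolding G filter_of_ultra[OF s] s_def[symmetric] by blast
    ultimately have "\<forall>\<^sub>F x in filter_of q. x \<notin> A"
      using U(1) by (auto simp: qU dest: filter_leD)
    then show False
      using A by (simp add: mem_iff_filter_of[OF q] filter_of_ultra[OF q])
  qed
  with q show ?thesis by (auto simp: returning_def)
qed

text \<open>An ideal contains the smallest ideal; this is how minimality of \<open>p\<close> yields
  the return property.\<close>

lemma returning_ideal: "two_sided_ideal returning"
  unfolding two_sided_ideal_def
proof (intro conjI ballI returning_nonempty)
  show "returning \<subseteq> betaN" by (auto simp: returning_def)
next
  fix q r
  assume "q \<in> returning" and r: "r \<in> betaN"
  then have q: "q \<in> betaN"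
    and ret: "\<And>A u. A \<in> q \<Longrightarrow> u \<in> betaN \<Longrightarrow> \<exists>b>0. \<forall>\<^sub>F y in filter_of (beta_add u q). b + y \<in> A"
    by (auto simp: returning_def)
  have "\<exists>b>0. \<forall>\<^sub>F y in filter_of (beta_add u (beta_add q r)). b + y \<in> A"
    if A: "A \<in> beta_add q r" and u: "u \<in> betaN" for A u
  proof -
    \<comment> \<open>Apply the property of \<open>q\<close> to the set of all \<open>x\<close> with
      \<open>-x + A \<in> r\<close>, then reassociate.\<close>
    have "{x \<in> posN. \<forall>\<^sub>F y in filter_of r. x + y \<in> A} \<in> q"
      using A by (simp add: beta_add_mem[OF q r] eventually_filter_of[OF q])
    from ret[OF this u] obtain b
      where "b > 0" "\<forall>\<^sub>F x in filter_of (beta_add u q). \<forall>\<^sub>F y in filter_of r. b + x + y \<in> A"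
      by (auto elim: eventually_mono)
    then show ?thesis
      by (auto simp: beta_add_assoc[OF u q r, symmetric] add.assoc
          eventually_beta_add[OF beta_add_closed[OF u q] r])
  qed
  then show "beta_add q r \<in> returning" by (simp add: returning_def beta_add_closed q r)
  have "\<exists>b>0. \<forall>\<^sub>F y in filter_of (beta_add u (beta_add r q)). b + y \<in> A"
    if A: "A \<in> beta_add r q" and u: "u \<in> betaN" for A u
  proof -
    \<comment> \<open>One fixed \<open>x\<close> with \<open>-x + A \<in> q\<close> reduces this to
      \<open>q\<close> with \<open>u + r\<close> in place of \<open>u\<close>; the final shift is
      \<open>x + b\<close>.\<close>
    have "\<forall>\<^sub>F x in filter_of r. 0 < x \<and> (\<forall>\<^sub>F y in filter_of q. x + y \<in> A)"
      using A filter_of_pos[OF r] by (simp add: beta_add_mem[OF r q] eventually_conj_iff)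
    then obtain x where "0 < x" and x: "\<forall>\<^sub>F y in filter_of q. x + y \<in> A"
      using eventually_happens' filter_of_neq_bot[OF r] by blast
    from x have "{y \<in> posN. x + y \<in> A} \<in> q" by (simp add: eventually_filter_of[OF q])
    from ret[OF this beta_add_closed[OF u r]] obtain b
      where "b > 0" "\<forall>\<^sub>F y in filter_of (beta_add u (beta_add r q)). x + (b + y) \<in> A"
      by (auto simp: beta_add_assoc[OF u r q] elim: eventually_mono)
    then show ?thesis by (intro exI[of _ "x + b"]) (simp add: add.assoc)
  qed
  then show "beta_add r q \<in> returning" by (simp add: returning_def beta_add_closed q r)
qed

lemma minimal_idempotent_returning: "minimal_idempotent p \<Longrightarrow> p \<in> returning"
  unfolding minimal_idempotent_def smallest_ideal_def using returning_ideal by blast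

section \<open>Iterated limits along a filter\<close>

text \<open>For an ultrafilter, this says that \<open>P\<close> holds on a member of
  \<open>c + a_0 p + ... + a_k p\<close>, with the sum taken in \<open>\<beta>\<int>\<close>.\<close>

primrec eventually_comb :: "nat filter \<Rightarrow> int list \<Rightarrow> (int \<Rightarrow> bool) \<Rightarrow> int \<Rightarrow> bool" where
  "eventually_comb F [] P c \<longleftrightarrow> P c"
| "eventually_comb F (a # as) P c \<longleftrightarrow> (\<forall>\<^sub>F x in F. eventually_comb F as P (c + a * int x))"

lemma eventually_comb_mono:
  "eventually_comb F as P c \<Longrightarrow> (\<And>z. P z \<Longrightarrow> Q z) \<Longrightarrow> eventually_comb F as Q c"
  by (induction as arbitrary: c) (auto elim: eventually_mono)

lemma eventually_comb_conj:
  "eventually_comb F as (\<lambda>z. P z \<and> Q z) c \<longleftrightarrow>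
    eventually_comb F as P c \<and> eventually_comb F as Q c"
  by (induction as arbitrary: c) (auto simp: eventually_conj_iff)

lemma eventually_comb_False: "F \<noteq> bot \<Longrightarrow> \<not> eventually_comb F as (\<lambda>z. False) c"
  by (induction as arbitrary: c) auto

lemma eventually_comb_not:
  assumes "\<And>P. eventually (\<lambda>x. \<not> P x) F \<longleftrightarrow> \<not> eventually P F"
  shows "eventually_comb F as (\<lambda>z. \<not> P z) c \<longleftrightarrow> \<not> eventually_comb F as P c"
  by (induction as arbitrary: c) (auto simp: assms)

lemma eventually_comb_shift:
  "eventually_comb F as (\<lambda>z. P (b + z)) c \<longleftrightarrow> eventually_comb F as P (b + c)"
  by (induction as arbitrary: c) (auto simp: add.assoc)

text \<open>The construction of the sequence sees \<open>p\<close> only through these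
  properties.\<close>

definition idempotent_filter :: "nat filter \<Rightarrow> bool" where
  "idempotent_filter F \<longleftrightarrow> F \<noteq> bot \<and> (\<forall>\<^sub>F x in F. 0 < x) \<and>
     (\<forall>P. eventually P F \<longleftrightarrow> (\<forall>\<^sub>F x in F. \<forall>\<^sub>F y in F. P (x + y)))"

lemma idempotent_filterD:
  assumes "idempotent_filter F"
  shows "F \<noteq> bot" "\<forall>\<^sub>F x in F. 0 < x"
    "eventually P F \<longleftrightarrow> (\<forall>\<^sub>F x in F. \<forall>\<^sub>F y in F. P (x + y))"
  using assms unfolding idempotent_filter_def by blast+

lemma idempotent_filter_of:
  assumes "p \<in> betaN" "beta_add p p = p"
  shows "idempotent_filter (filter_of p)"
  using assms eventually_beta_add[OF assms(1) assms(1)]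
  by (simp add: idempotent_filter_def filter_of_neq_bot filter_of_pos)

text \<open>Idempotents are nonprincipal: a sum of \<open>x \<ge> m\<close> and \<open>y > 0\<close>
  exceeds \<open>m\<close>.\<close>

lemma idempotent_filter_ge:
  assumes "idempotent_filter F"
  shows "\<forall>\<^sub>F x in F. m \<le> x"
proof (induction m)
  case (Suc m)
  have "\<forall>\<^sub>F x in F. \<forall>\<^sub>F y in F. Suc m \<le> x + y"
    using Suc
  proof eventually_elim
    fix x assume "m \<le> x"
    show "\<forall>\<^sub>F y in F. Suc m \<le> x + y"
      using idempotent_filterD(2)[OF assms] by eventually_elim (use \<open>m \<le> x\<close> in simp)
  qed
  then show ?case using idempotent_filterD(3)[OF assms, of "\<lambda>x. Suc m \<le> x"] by blast
qed simp

text \<open>The coefficient \<open>1\<close> belongs to the innermost variable, which is chosen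
  after the partial sum and so can outweigh it. The combination thus lies in
  \<open>betaN\<close>.\<close>

lemma eventually_comb_snoc_pos:
  assumes "idempotent_filter F"
  shows "eventually_comb F (as @ [1]) (\<lambda>z. 0 < z) c"
proof (induction as arbitrary: c)
  case Nil
  have "\<forall>\<^sub>F x in F. nat (1 - c) \<le> x" by (rule idempotent_filter_ge[OF assms])
  then show ?case by (simp, eventually_elim) linarith
qed simp

text \<open>The identity \<open>s = s + p\<close>: the extra \<open>p\<close> is absorbed into the
  last summand by idempotency.\<close>

lemma eventually_comb_snoc_add:
  assumes "idempotent_filter F"
  shows "eventually_comb F (as @ [1]) (\<lambda>z. \<forall>\<^sub>F y in F. P (z + int y)) c \<longleftrightarrow>
    eventually_comb F (as @ [1]) P c"
proof (induction as arbitrary: c)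
  case Nil
  show ?case
    using idempotent_filterD(3)[OF assms, of "\<lambda>x. P (c + int x)"] by (simp add: add.assoc)
qed simp

text \<open>Since \<open>a * x + a * y = a * (x + y)\<close>, idempotency allows a block to grow by
  another term.\<close>

lemma eventually_idempotent_iterate:
  assumes "idempotent_filter F" "\<forall>\<^sub>F x in F. P (c + a * int x)"
  shows "\<forall>\<^sub>F x in F. \<forall>\<^sub>F y in F. P (c + a * int x + a * int y)"
  using assms(2) idempotent_filterD(3)[OF assms(1), of "\<lambda>x. P (c + a * int x)"]
  by (simp add: distrib_left add.assoc)

lemma ex_shift_eventually_comb:
  assumes p: "minimal_idempotent p" and A: "A \<in> p"
  obtains b where "b > 0" "eventually_comb (filter_of p) (as @ [1]) (\<lambda>z. z \<in> int ` A) (int b)"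
proof -
  let ?F = "filter_of p"
  have pN: "p \<in> betaN" and idem: "beta_add p p = p"
    using p by (auto simp: minimal_idempotent_def)
  have F: "idempotent_filter ?F" by (rule idempotent_filter_of[OF pN idem])
  \<comment> \<open>The combination is moved from the integers to \<open>nat\<close>. As
    \<open>nat\<close> sends negative integers to \<open>0\<close>, positivity is built in; it holds
    almost always anyway.\<close>
  let ?L = "\<lambda>P. eventually_comb ?F (as @ [1]) (\<lambda>z. 0 < z \<and> P (nat z)) 0"
  define s where "s = {B. B \<subseteq> posN \<and> ?L (\<lambda>x. x \<in> B)}"
  note pos = eventually_comb_snoc_pos[OF F]
  have L: "?L P \<longleftrightarrow> eventually_comb ?F (as @ [1]) (\<lambda>z. P (nat z)) 0" for P
    by (simp add: eventually_comb_conj pos)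
  have s: "s \<in> betaN"
  proof (rule betaN_I[where L = ?L])
    show "?L P \<or> ?L (\<lambda>x. \<not> P x)" for P
      unfolding L[of P] L[of "\<lambda>x. \<not> P x"] by (simp add: eventually_comb_not filter_of_ultra[OF pN])
    show "\<not> ?L (\<lambda>x. False)"
      using eventually_comb_False filter_of_neq_bot[OF pN] by simp
    show "?L (\<lambda>x. 0 < x)" using pos by (simp add: eventually_comb_conj)
    show "?L (\<lambda>x. P x \<and> Q x)" if "?L P" "?L Q" for P Q
      using that by (simp add: eventually_comb_conj)
    show "?L Q" if "?L P" "\<And>x. P x \<Longrightarrow> Q x" for P Q
      using that(1) by (rule eventually_comb_mono) (use that(2) in blast)
  qed (simp add: s_def)
  have ev: "eventually P (filter_of s) \<longleftrightarrow> ?L P" for P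
  proof -
    have "eventually P (filter_of s) \<longleftrightarrow> ?L (\<lambda>x. x \<in> {x \<in> posN. P x})"
      unfolding eventually_filter_of[OF s] by (subst s_def) (simp only: mem_Collect_eq, blast)
    also have "\<dots> \<longleftrightarrow> ?L P"
      by (rule iffI; erule eventually_comb_mono) auto
    finally show ?thesis .
  qed
  have "B \<in> beta_add s p \<longleftrightarrow> B \<in> s" for B
  proof -
    \<comment> \<open>For positive \<open>z\<close>, \<open>nat (z + int y) = nat z + y\<close>, so
      the absorption of \<open>p\<close> can be used over the integers.\<close>
    have "?L (\<lambda>x. \<forall>\<^sub>F y in ?F. x + y \<in> B) \<longleftrightarrow>
        eventually_comb ?F (as @ [1]) (\<lambda>z. 0 < z \<and> (\<forall>\<^sub>F y in ?F. nat (z + int y) \<in> B)) 0"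
      by (rule iffI; erule eventually_comb_mono) (auto simp: nat_add_distrib)
    also have "\<dots> \<longleftrightarrow> eventually_comb ?F (as @ [1]) (\<lambda>z. nat z \<in> B) 0"
      using eventually_comb_snoc_add[OF F, of as "\<lambda>z. nat z \<in> B"]
      by (simp add: eventually_comb_conj pos)
    also have "\<dots> \<longleftrightarrow> ?L (\<lambda>x. x \<in> B)" by (rule L[symmetric])
    finally show ?thesis
      unfolding beta_add_mem[OF s pN] ev by (subst s_def) (simp only: mem_Collect_eq)
  qed
  then have "beta_add s p = s" by blast
  \<comment> \<open>Here \<open>s = s + p\<close> is the element \<open>u + p\<close> with
    \<open>u = s\<close> in the definition of \<open>returning\<close>.\<close>
  with minimal_idempotent_returning[OF p] A s obtain b
    where b: "b > 0" "\<forall>\<^sub>F y in filter_of s. b + y \<in> A"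
    unfolding returning_def by force
  have "eventually_comb ?F (as @ [1]) (\<lambda>z. int b + z \<in> int ` A) 0"
    using b(2) unfolding ev
  proof (rule eventually_comb_mono)
    fix z assume "0 < z \<and> b + nat z \<in> A"
    then show "int b + z \<in> int ` A" by (intro image_eqI[of _ _ "b + nat z"]) auto
  qed
  then have "eventually_comb ?F (as @ [1]) (\<lambda>z. z \<in> int ` A) (int b)"
    using eventually_comb_shift[of ?F "as @ [1]" "\<lambda>z. z \<in> int ` A" "int b" 0] by simp
  with b(1) show ?thesis using that by blast
qed

section \<open>Building the sequence\<close>

text \<open>A state \<open>(i, j, c)\<close> records that for the \<open>i\<close>-th family the block with coefficient number
  \<open>j\<close> is in progress (and nonempty) and that the partial sum so far is \<open>c\<close>. A state can be
  continued with a new term by enlarging the current block or by opening the next one;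
  family \<open>i\<close> may be entered with the term number \<open>i - 1\<close> or any later one.\<close>

definition next_states ::
    "(nat \<Rightarrow> int list) \<Rightarrow> (nat \<Rightarrow> int) \<Rightarrow> nat \<Rightarrow> nat \<Rightarrow> (nat \<times> nat \<times> int) set
      \<Rightarrow> (nat \<times> nat \<times> int) set" where
  "next_states cs b n y R = R
     \<union> (\<lambda>(i, j, c). (i, j, c + cs i ! j * int y)) ` R
     \<union> (\<lambda>(i, j, c). (i, Suc j, c + cs i ! Suc j * int y))
         ` {s \<in> R. Suc (fst (snd s)) < length (cs (fst s))}
     \<union> (\<lambda>i. (i, 0, b i + cs i ! 0 * int y)) ` {..Suc n}"

text \<open>The first conjunct lets the block end at \<open>c\<close>: the remaining coefficients
  almost always lead into \<open>P\<close>. The second lets the block take another term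
  first.\<close>

definition good_state ::
    "nat filter \<Rightarrow> (nat \<Rightarrow> int list) \<Rightarrow> (int \<Rightarrow> bool) \<Rightarrow> nat \<times> nat \<times> int \<Rightarrow> bool" where
  "good_state F cs P = (\<lambda>(i, j, c).
     eventually_comb F (drop (Suc j) (cs i)) P c \<and>
     (\<forall>\<^sub>F y in F. eventually_comb F (drop (Suc j) (cs i)) P (c + cs i ! j * int y)))"

text \<open>Unfolding the leading coefficient gives the first promise for almost all
  \<open>y\<close>; idempotency, splitting \<open>y\<close> into a sum, gives the second.\<close>

lemma good_state_enter:
  assumes F: "idempotent_filter F" and j: "j < length (cs i)"
    and "eventually_comb F (drop j (cs i)) P c"
  shows "\<forall>\<^sub>F y in F. good_state F cs P (i, j, c + cs i ! j * int y)"
proof -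
  have *: "\<forall>\<^sub>F y in F. eventually_comb F (drop (Suc j) (cs i)) P (c + cs i ! j * int y)"
    using assms(3) by (simp add: Cons_nth_drop_Suc[OF j, symmetric])
  from * eventually_idempotent_iterate[OF F *] show ?thesis
    by eventually_elim (simp add: good_state_def)
qed

lemma good_state_continue:
  assumes F: "idempotent_filter F" and "good_state F cs P (i, j, c)"
  shows "\<forall>\<^sub>F y in F. good_state F cs P (i, j, c + cs i ! j * int y)"
proof -
  have *: "\<forall>\<^sub>F y in F. eventually_comb F (drop (Suc j) (cs i)) P (c + cs i ! j * int y)"
    using assms(2) by (simp add: good_state_def)
  from * eventually_idempotent_iterate[OF F *] show ?thesis
    by eventually_elim (simp add: good_state_def)
qed

text \<open>Each new state imposes one eventual condition on \<open>y\<close>, and finitely many of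
  them have a common solution.\<close>

lemma good_next_states:
  assumes F: "idempotent_filter F"
    and R: "finite R" "\<forall>s\<in>R. good_state F cs P s"
    and start: "\<And>i. cs i \<noteq> []" "\<And>i. eventually_comb F (cs i) P (b i)"
  shows "\<exists>y>0. \<forall>s \<in> next_states cs b n y R. good_state F cs P s"
proof -
  have "\<forall>\<^sub>F y in F. \<forall>s\<in>R. good_state F cs P
      ((\<lambda>(i, j, c). (i, j, c + cs i ! j * int y)) s)"
  proof (intro eventually_ball_finite R(1) ballI)
    fix s assume "s \<in> R"
    then show "\<forall>\<^sub>F y in F. good_state F cs P ((\<lambda>(i, j, c). (i, j, c + cs i ! j * int y)) s)"
      using good_state_continue[OF F] R(2) by (cases s) auto
  qed
  moreover have "\<forall>\<^sub>F y in F. \<forall>s\<in>{s \<in> R. Suc (fst (snd s)) < length (cs (fst s))}.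
      good_state F cs P ((\<lambda>(i, j, c). (i, Suc j, c + cs i ! Suc j * int y)) s)"
  proof (intro eventually_ball_finite ballI)
    show "finite {s \<in> R. Suc (fst (snd s)) < length (cs (fst s))}" using R(1) by simp
    fix s assume "s \<in> {s \<in> R. Suc (fst (snd s)) < length (cs (fst s))}"
    moreover obtain i j c where "s = (i, j, c)" by (cases s)
    ultimately have "Suc j < length (cs i)" "eventually_comb F (drop (Suc j) (cs i)) P c"
      using R(2) by (auto simp: good_state_def)
    from good_state_enter[of F "Suc j" cs i P c, OF F this] \<open>s = (i, j, c)\<close>
    show "\<forall>\<^sub>F y in F. good_state F cs P
        ((\<lambda>(i, j, c). (i, Suc j, c + cs i ! Suc j * int y)) s)" by simp
  qed
  \<comment> \<open>Family \<open>i\<close> may be entered only once \<open>i \<le> Suc n\<close>,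
    which keeps the conditions finite in number although there are infinitely many families.\<close>
  moreover have "\<forall>\<^sub>F y in F. \<forall>i\<in>{..Suc n}. good_state F cs P (i, 0, b i + cs i ! 0 * int y)"
    using good_state_enter[OF F, of 0 cs] start by (intro eventually_ball_finite) auto
  ultimately have "\<forall>\<^sub>F y in F. 0 < y \<and> (\<forall>s \<in> next_states cs b n y R. good_state F cs P s)"
    using idempotent_filterD(2)[OF F]
    by eventually_elim (use R(2) in \<open>simp add: next_states_def ball_Un\<close>)
  then show ?thesis
    using eventually_happens' idempotent_filterD(1)[OF F] by blast
qed

text \<open>\<open>R n\<close> is meant to hold the states formed from terms before number
  \<open>n\<close>. The block is built in increasing order; while terms are skipped, monotonicity of
  \<open>R\<close> carries the state along.\<close>

lemma block_states:
  fixes x :: "nat \<Rightarrow> nat" and R :: "nat \<Rightarrow> (nat \<times> nat \<times> int) set"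
  assumes mono: "mono R"
    and enter: "\<And>n. m \<le> n \<Longrightarrow> (i, j, c + a * int (x n)) \<in> R (Suc n)"
    and continue: "\<And>n d. (i, j, d) \<in> R n \<Longrightarrow> (i, j, d + a * int (x n)) \<in> R (Suc n)"
    and G: "finite G" "G \<noteq> {}" "G \<subseteq> {m..}"
  shows "(i, j, c + a * (\<Sum>t\<in>G. int (x t))) \<in> R (Suc (Max G))"
  using G
proof (induction G rule: finite_linorder_max_induct)
  case (insert n G)
  have Max: "Max (insert n G) = n" using insert by (intro Max_eqI) auto
  show ?case
  proof (cases "G = {}")
    case True
    then show ?thesis using enter insert by simp
  next
    case False
    then have "(i, j, c + a * (\<Sum>t\<in>G. int (x t))) \<in> R (Suc (Max G))" using insert by simp
    moreover have "Suc (Max G) \<le> n" using insert False by (simp add: Suc_le_eq)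
    ultimately have "(i, j, c + a * (\<Sum>t\<in>G. int (x t))) \<in> R n"
      using monoD[OF mono] by blast
    from continue[OF this] show ?thesis
      unfolding Max using insert by (auto simp: algebra_simps)
  qed
qed simp

text \<open>The bound \<open>i - 1\<close> is truncated: families \<open>0\<close> and
  \<open>1\<close> both start at term \<open>0\<close>, leaving family \<open>0\<close> free for the
  finite sums.\<close>

lemma milliken_taylor:
  assumes F: "idempotent_filter F"
    and ne: "\<And>i. cs i \<noteq> []" and start: "\<And>i. eventually_comb F (cs i) P (b i)"
  obtains x :: "nat \<Rightarrow> nat" where "\<And>n. 0 < x n"
    and "\<And>i k G. length (cs i) = Suc k \<Longrightarrow> \<forall>j\<le>k. G j \<in> Pf {i - 1..} \<Longrightarrow>
      \<forall>j<k. block_less (G j) (G (Suc j)) \<Longrightarrow>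
      P (b i + (\<Sum>j\<le>k. cs i ! j * (\<Sum>t\<in>G j. int (x t))))"
proof -
  \<comment> \<open>The next term is chosen from the whole set of states, so that it meets every
    promise made so far.\<close>
  define ch where "ch n R = (SOME y. 0 < y \<and>
    (\<forall>s \<in> next_states cs b n y R. good_state F cs P s))" for n R
  define R where "R = rec_nat {} (\<lambda>n R. next_states cs b n (ch n R) R)"
  define x where "x n = ch n (R n)" for n
  have R0: "R 0 = {}" and RS: "R (Suc n) = next_states cs b n (x n) (R n)" for n
    by (simp_all add: R_def x_def)
  have fin: "finite (R n)" for n
    by (induction n) (auto simp: R0 RS next_states_def)
  have ch: "0 < ch n S \<and> (\<forall>s \<in> next_states cs b n (ch n S) S. good_state F cs P s)"
    if "finite S" "\<forall>s\<in>S. good_state F cs P s" for n S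
    unfolding ch_def using good_next_states[OF F that ne start] by (rule someI_ex)
  have good: "\<forall>s\<in>R n. good_state F cs P s" for n
  proof (induction n)
    case (Suc n)
    then show ?case using ch[OF fin Suc] by (simp add: RS x_def)
  qed (simp add: R0)
  have "mono R" by (rule mono_iff_le_Suc[THEN iffD2]) (auto simp: RS next_states_def)
  have enter: "(i, 0, b i + cs i ! 0 * int (x n)) \<in> R (Suc n)" if "i - 1 \<le> n" for i n
    using that by (auto simp: RS next_states_def)
  have continue: "(i, j, d + cs i ! j * int (x n)) \<in> R (Suc n)" if "(i, j, d) \<in> R n" for i j d n
    using that by (force simp: RS next_states_def)
  have succ: "(i, Suc j, d + cs i ! Suc j * int (x n)) \<in> R (Suc n)"
    if "(i, j, d) \<in> R n" "Suc j < length (cs i)" for i j d n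
    using that by (force simp: RS next_states_def)
  \<comment> \<open>Induction over the blocks: once block \<open>j\<close> is complete at stage
    \<open>Suc (Max (G j))\<close>, every later term may open the next block.\<close>
  have reach: "(i, j, b i + (\<Sum>l\<le>j. cs i ! l * (\<Sum>t\<in>G l. int (x t)))) \<in> R (Suc (Max (G j)))"
    if len: "length (cs i) = Suc k" and G: "\<forall>j\<le>k. G j \<in> Pf {i - 1..}"
      and less: "\<forall>j<k. block_less (G j) (G (Suc j))" and "j \<le> k" for i k G j
    using \<open>j \<le> k\<close>
  proof (induction j)
    case 0
    from G have "finite (G 0)" "G 0 \<noteq> {}" "G 0 \<subseteq> {i - 1..}" by (auto simp: Pf_def)
    from block_states[OF \<open>mono R\<close> enter continue this] show ?case by simp
  next
    case (Suc j)
    let ?d = "b i + (\<Sum>l\<le>j. cs i ! l * (\<Sum>t\<in>G l. int (x t)))"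
    from Suc have IH: "(i, j, ?d) \<in> R (Suc (Max (G j)))" by simp
    have ent: "(i, Suc j, ?d + cs i ! Suc j * int (x n)) \<in> R (Suc n)" if "Suc (Max (G j)) \<le> n" for n
      using IH monoD[OF \<open>mono R\<close> that] Suc.prems len by (intro succ) auto
    have "finite (G (Suc j))" "G (Suc j) \<noteq> {}" using G Suc.prems by (auto simp: Pf_def)
    moreover have "G (Suc j) \<subseteq> {Suc (Max (G j))..}"
    proof
      fix t assume "t \<in> G (Suc j)"
      then have "Min (G (Suc j)) \<le> t" using \<open>finite (G (Suc j))\<close> by simp
      moreover have "Max (G j) < Min (G (Suc j))"
        using less Suc.prems by (simp add: block_less_def)
      ultimately show "t \<in> {Suc (Max (G j))..}" by simp
    qed
    ultimately show ?case
      using block_states[OF \<open>mono R\<close> ent continue] by (simp add: add.assoc)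
  qed
  show ?thesis
  proof
    show "0 < x n" for n using ch[OF fin good] by (simp add: x_def)
    fix i k G
    assume len: "length (cs i) = Suc k" and "\<forall>j\<le>k. G j \<in> Pf {i - 1..}"
      "\<forall>j<k. block_less (G j) (G (Suc j))"
    from reach[OF this order_refl] good
    have "good_state F cs P (i, k, b i + (\<Sum>l\<le>k. cs i ! l * (\<Sum>t\<in>G l. int (x t))))"
      by blast
    \<comment> \<open>No coefficients remain after block \<open>k\<close>, so the first promise of
      the state is \<open>P\<close> itself.\<close>
    then show "P (b i + (\<Sum>j\<le>k. cs i ! j * (\<Sum>t\<in>G j. int (x t))))"
      using len by (simp add: good_state_def)
  qed
qed

theorem theorem6p3:
  fixes k :: "nat \<Rightarrow> nat" and a :: "nat \<Rightarrow> nat \<Rightarrow> int"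
    and p :: "nat set set" and A :: "nat set"
  assumes "\<And>i. k i \<ge> 1"
    and "\<And>i. compressed (k i) (a i)"
    and "\<And>i. a i (k i) = 1"
    and "minimal_idempotent p"
    and "A \<in> p"
  shows "\<exists>(b :: nat \<Rightarrow> nat) (x :: nat \<Rightarrow> nat).
    (\<forall>n. b n \<in> posN) \<and> (\<forall>n. x n \<in> posN) \<and>
    FS x \<subseteq> A \<and>
    (\<forall>i. (\<lambda>z. int (b i) + z) ` MT (k i) (a i) i x \<subseteq> int ` A)"
proof -
  have p: "p \<in> betaN" "beta_add p p = p"
    using assms(4) by (auto simp: minimal_idempotent_def)
  have F: "idempotent_filter (filter_of p)" by (rule idempotent_filter_of[OF p])
  \<comment> \<open>The literal \<open>1\<close> stands for \<open>a i (k i)\<close> and brings the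
    sequence into the form \<open>as @ [1]\<close>.\<close>
  let ?as = "\<lambda>i. map (a i) [0..<k i] @ [1]"
  have "\<exists>b>0. eventually_comb (filter_of p) (?as i) (\<lambda>z. z \<in> int ` A) (int b)" for i
    using ex_shift_eventually_comb[OF assms(4,5)] by metis
  then obtain b where b: "\<And>i. 0 < b i"
    "\<And>i. eventually_comb (filter_of p) (?as i) (\<lambda>z. z \<in> int ` A) (int (b i))"
    by metis
  \<comment> \<open>Finite sums are treated as family \<open>0\<close>, with the single coefficient \<open>1\<close> and shift \<open>0\<close>.\<close>
  define cs where "cs = case_nat [1] ?as"
  define c where "c = case_nat 0 (\<lambda>i. int (b i))"
  have "cs i \<noteq> []" for i by (cases i) (auto simp: cs_def)
  \<comment> \<open>For family \<open>0\<close> the claim is just \<open>A \<in> p\<close>.\<close>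
  moreover have "eventually_comb (filter_of p) (cs i) (\<lambda>z. z \<in> int ` A) (c i)" for i
    using b assms(5) mem_iff_filter_of[OF p(1)]
    by (cases i) (auto simp: cs_def c_def inj_image_mem_iff)
  ultimately obtain x :: "nat \<Rightarrow> nat" where x: "\<And>n. 0 < x n"
    and MT: "\<And>i k G. length (cs i) = Suc k \<Longrightarrow> \<forall>j\<le>k. G j \<in> Pf {i - 1..} \<Longrightarrow>
      \<forall>j<k. block_less (G j) (G (Suc j)) \<Longrightarrow>
      c i + (\<Sum>j\<le>k. cs i ! j * (\<Sum>t\<in>G j. int (x t))) \<in> int ` A"
    by (rule milliken_taylor[OF F, of cs "\<lambda>z. z \<in> int ` A" c]) blast+
  have "FS x \<subseteq> A"
  proof
    fix z assume "z \<in> FS x"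
    then obtain G where G: "G \<in> Pf UNIV" "z = (\<Sum>t\<in>G. x t)" by (auto simp: FS_def)
    have "c 0 + (\<Sum>j\<le>0. cs 0 ! j * (\<Sum>t\<in>G. int (x t))) \<in> int ` A"
      using G(1) by (intro MT) (auto simp: cs_def Pf_def)
    then show "z \<in> A" using G(2) by (auto simp: c_def cs_def simp flip: of_nat_sum)
  qed
  moreover have "int (b i) + z \<in> int ` A" if z: "z \<in> MT (k i) (a i) i x" for i z
  proof -
    from z obtain G where G: "z = (\<Sum>j\<le>k i. a i j * (\<Sum>t\<in>G j. int (x t)))"
      "\<forall>j\<le>k i. G j \<in> Pf {i..}" "\<forall>j<k i. block_less (G j) (G (Suc j))"
      unfolding MT_def by blast
    \<comment> \<open>Sequence \<open>i\<close> is family \<open>Suc i\<close>, so its blocks may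
      start at term \<open>Suc i - 1 = i\<close>.\<close>
    have "c (Suc i) + (\<Sum>j\<le>k i. cs (Suc i) ! j * (\<Sum>t\<in>G j. int (x t))) \<in> int ` A"
      using G by (intro MT) (auto simp: cs_def)
    moreover have "cs (Suc i) ! j = a i j" if "j \<le> k i" for j
      using that assms(3)[of i] by (cases "j = k i") (auto simp: cs_def nth_append)
    ultimately show ?thesis by (simp add: G(1) c_def)
  qed
  ultimately show ?thesis
    using b(1) x by (intro exI[of _ b] exI[of _ x]) (auto simp: Suc_le_eq)
qed

end
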